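(* Let $d\ge2$, $p\ge1$, and let $M\subset\mathbb{R}^d$ be open, connected and bounded with smooth boundary. Assume that there are constants $C_1(M)$ and $C_2(M,p)$ such that for all $V\in L^2(M,\mathbb{R}^{d\times d})$ with $dV\in L^p(M)$ there exists a rotation $R\in\mathrm{SO}(d)$ with $$\|V-R\|_{L^2(M)}\le C_1(M)\,\|\operatorname{dist}(V,\mathrm{SO}(d))\|_{L^2(M)}+C_2(M,p)\,\|dV\|_{L^p(M)}.$$ Let $\eta>0$. Then the same holds on the scaled domain $\eta M$ with the constants $$C_1(\eta M)=C_1(M)\qquad\text{and}\qquad C_2(\eta M,p)=\eta^{\frac d2-\frac dp+1}\,C_2(M,p),$$ i.e. for all $V\in L^2(\eta M,\mathbb{R}^{d\times d})$ with $dV\in L^p(\eta M)$ there exists $R\in\mathrm{SO}(d)$ with $$\|V-R\|_{L^2(\eta M)}\le C_1(M)\,\|\operatorname{dist}(V,\mathrm{SO}(d))\|_{L^2(\eta M)}+\eta^{\frac d2-\frac dp+1}C_2(M,p)\,\|dV\|_{L^p(\eta M)}.$$ The same statement is true if $M$ is replaced by a $d$-dimensional torus $[M]$ and $\eta M$ by the torus scaled by $\eta$.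
   Context: A $d$-dimensional torus is a flat torus $[M]=\mathbb{R}^d/\{z_1v_1+\dots+z_dv_d\mid z_j\in\mathbb{Z}\}$ with linearly independent $v_1,\dots,v_d$; the scaled torus is obtained by replacing each $v_j$ with $\eta v_j$. A matrix-valued function $V=(V_{ij})$ is identified line by line with a vector $(V_i)_{1\le i\le d}$ of 1-forms $V_i=\sum_{j}V_{ij}\,dx_j$. Its exterior derivative is $dV=(dV_i)_i$ with $dV_i=\sum_{k<l}(\partial_kV_{il}-\partial_lV_{ik})\,dx_k\wedge dx_l$, and $\|dV\|_{L^p}^p:=\sum_{i=1}^d\sum_{k<l}\|\partial_kV_{il}-\partial_lV_{ik}\|_{L^p}^p$. For $V\in L^2$, one says that $dV\in L^p$ (for $p\ge1$) if there exist smooth $V^n\in L^2$ with $V^n\to V$ in $L^2$ such that $(dV^n)_n$ is a Cauchy sequence in $L^p$; then $dV:=L^p\text{-}\lim_n dV^n$ (well defined). $\operatorname{dist}(V,\mathrm{SO}(d))$ is taken point-wise. *)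

theory Defs
  imports "HOL-Analysis.Analysis"
begin

section \<open>Smooth functions and smooth domains\<close>

definition partial :: "'n \<Rightarrow> (real^'n \<Rightarrow> 'b::real_normed_vector) \<Rightarrow> real^'n \<Rightarrow> 'b" where
  "partial k f x = frechet_derivative f (at x) (axis k 1)"

text \<open>Meaningful for open \<open>U\<close> only, since \<^const>\<open>partial\<close> takes derivatives in the full space.\<close>

primrec Ck_on :: "nat \<Rightarrow> (real^'n) set \<Rightarrow> (real^'n \<Rightarrow> 'b::real_normed_vector) \<Rightarrow> bool" where
  "Ck_on 0 U f \<longleftrightarrow> continuous_on U f"
| "Ck_on (Suc m) U f \<longleftrightarrow> (\<forall>x\<in>U. f differentiable (at x)) \<and> (\<forall>k. Ck_on m U (partial k f))"

definition smooth_on :: "(real^'n) set \<Rightarrow> (real^'n \<Rightarrow> 'b::real_normed_vector) \<Rightarrow> bool" where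
  "smooth_on U f \<longleftrightarrow> (\<forall>m. Ck_on m U f)"

text \<open>Smooth boundary: near each boundary point, \<open>M\<close> is the sublevel set of a smooth
  local defining function with non-vanishing gradient, i.e. \<open>M\<close> lies locally on one side of
  a smooth hypersurface.\<close>

definition smooth_boundary :: "(real^'n) set \<Rightarrow> bool" where
  "smooth_boundary M \<longleftrightarrow>
     (\<forall>a\<in>frontier M. \<exists>U (\<rho> :: real^'n \<Rightarrow> real).
        open U \<and> a \<in> U \<and> smooth_on U \<rho> \<and>
        (\<forall>x\<in>U. \<exists>k. partial k \<rho> x \<noteq> 0) \<and> M \<inter> U = {x \<in> U. \<rho> x < 0})"

section \<open>Lebesgue spaces, \<open>1 \<le> p < \<infinity>\<close>\<close>

text \<open>Elements are functions, not classes modulo null sets. Matrices in \<open>real^'n^'n\<close> carry the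
  Frobenius norm, which is the library norm on that type.\<close>

definition Lp :: "real \<Rightarrow> 'a measure \<Rightarrow> ('a \<Rightarrow> 'b::euclidean_space) set" where
  "Lp p \<mu> = {f \<in> borel_measurable \<mu>. integrable \<mu> (\<lambda>x. norm (f x) powr p)}"

definition Lp_norm :: "real \<Rightarrow> 'a measure \<Rightarrow> ('a \<Rightarrow> 'b::euclidean_space) \<Rightarrow> real" where
  "Lp_norm p \<mu> f = (\<integral>x. norm (f x) powr p \<partial>\<mu>) powr (1 / p)"

section \<open>The exterior derivative of a matrix field\<close>

text \<open>A vector of 2-forms \<open>\<Sum>k<l. W i k l x dx\<^sub>k \<and> dx\<^sub>l\<close> is represented by its coefficients \<open>W i k l\<close>;
  only those with \<open>k < l\<close> are relevant. The coordinates are indexed by a finite linearly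
  ordered type. (The synonyms avoid the postfix syntax for vector types, which would fix the sort
  of \<open>'n\<close> to be \<open>finite\<close>.)\<close>

type_synonym 'n vector = "(real, 'n) vec"
type_synonym 'n field_of_matrices = "'n vector \<Rightarrow> ('n vector, 'n) vec"
type_synonym 'n two_forms = "'n \<Rightarrow> 'n \<Rightarrow> 'n \<Rightarrow> 'n vector \<Rightarrow> real"

definition ext_d :: "('n::finite) field_of_matrices \<Rightarrow> 'n two_forms" where
  "ext_d V = (\<lambda>i k l x. partial k (\<lambda>y. V y $ i $ l) x - partial l (\<lambda>y. V y $ i $ k) x)"

definition forms_Lp :: "real \<Rightarrow> ('n::{finite,linorder}) vector measure \<Rightarrow> 'n two_forms set" where
  "forms_Lp p \<mu> = {W. \<forall>i k l. k < l \<longrightarrow> W i k l \<in> Lp p \<mu>}"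

definition forms_norm :: "real \<Rightarrow> ('n::{finite,linorder}) vector measure \<Rightarrow> 'n two_forms \<Rightarrow> real" where
  "forms_norm p \<mu> W = (\<Sum>i\<in>UNIV. \<Sum>(k, l)\<in>{(k, l). k < l}. Lp_norm p \<mu> (W i k l) powr p) powr (1 / p)"

definition forms_diff :: "'n two_forms \<Rightarrow> 'n two_forms \<Rightarrow> 'n two_forms" where
  "forms_diff W W' = (\<lambda>i k l x. W i k l x - W' i k l x)"

text \<open>In the following, \<open>S\<close> is the set of smooth fields on the manifold under consideration
  and \<open>\<mu>\<close> is its volume measure.\<close>

definition approx_seq ::
  "('n::{finite,linorder}) field_of_matrices set \<Rightarrow> 'n vector measure \<Rightarrow> real \<Rightarrow>
   'n field_of_matrices \<Rightarrow> (nat \<Rightarrow> 'n field_of_matrices) \<Rightarrow> bool" where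
  "approx_seq S \<mu> p V Vn \<longleftrightarrow>
     (\<forall>n. Vn n \<in> S \<inter> Lp 2 \<mu>) \<and>
     (\<lambda>n. Lp_norm 2 \<mu> (\<lambda>x. Vn n x - V x)) \<longlonglongrightarrow> 0 \<and>
     (\<forall>n. ext_d (Vn n) \<in> forms_Lp p \<mu>) \<and>
     (\<forall>e>0. \<exists>N. \<forall>m\<ge>N. \<forall>n\<ge>N. forms_norm p \<mu> (forms_diff (ext_d (Vn m)) (ext_d (Vn n))) < e)"

definition ext_d_in_Lp ::
  "('n::{finite,linorder}) field_of_matrices set \<Rightarrow> 'n vector measure \<Rightarrow> real \<Rightarrow>
   'n field_of_matrices \<Rightarrow> bool" where
  "ext_d_in_Lp S \<mu> p V \<longleftrightarrow> (\<exists>Vn. approx_seq S \<mu> p V Vn)"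

text \<open>\<open>W\<close> is (a representative of) the \<open>L\<^sup>p\<close>-limit \<open>dV\<close>. Such a \<open>W\<close> exists whenever
  \<^const>\<open>ext_d_in_Lp\<close> holds, because \<open>L\<^sup>p\<close> is complete, and is unique up to null sets.\<close>

definition is_ext_d ::
  "('n::{finite,linorder}) field_of_matrices set \<Rightarrow> 'n vector measure \<Rightarrow> real \<Rightarrow>
   'n field_of_matrices \<Rightarrow> 'n two_forms \<Rightarrow> bool" where
  "is_ext_d S \<mu> p V W \<longleftrightarrow> W \<in> forms_Lp p \<mu> \<and>
     (\<exists>Vn. approx_seq S \<mu> p V Vn \<and>
           (\<lambda>n. forms_norm p \<mu> (forms_diff (ext_d (Vn n)) W)) \<longlonglongrightarrow> 0)"

section \<open>The rigidity estimate\<close>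

definition SO :: "(real^'n^'n) set" where
  "SO = {R. rotation_matrix R}"

text \<open>\<open>F\<close> is the set of fields on the manifold. The quantifier over \<open>W\<close> ranges over the
  representatives of \<open>dV\<close>.\<close>

definition rigidity_estimate ::
  "('n::{finite,linorder}) field_of_matrices set \<Rightarrow> 'n field_of_matrices set \<Rightarrow> 'n vector measure \<Rightarrow>
   real \<Rightarrow> real \<Rightarrow> real \<Rightarrow> bool" where
  "rigidity_estimate F S \<mu> p C1 C2 \<longleftrightarrow>
     (\<forall>V \<in> F \<inter> Lp 2 \<mu>. ext_d_in_Lp S \<mu> p V \<longrightarrow>
        (\<exists>R\<in>SO. \<forall>W. is_ext_d S \<mu> p V W \<longrightarrow>
           Lp_norm 2 \<mu> (\<lambda>x. V x - R) \<le>
             C1 * Lp_norm 2 \<mu> (\<lambda>x. infdist (V x) SO) + C2 * forms_norm p \<mu> W))"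

text \<open>Fields on a domain \<open>M\<close> are total functions whose values outside \<open>M\<close> are irrelevant.\<close>

definition domain_rigidity :: "('n::{finite,linorder}) vector set \<Rightarrow> real \<Rightarrow> real \<Rightarrow> real \<Rightarrow> bool" where
  "domain_rigidity M p C1 C2 \<longleftrightarrow>
     rigidity_estimate UNIV {U. smooth_on M U} (lebesgue_on M) p C1 C2"

text \<open>Functions on the torus \<open>\<real>\<^sup>d / (\<int> v\<^sub>1 + \<dots> + \<int> v\<^sub>d)\<close> are the lattice-periodic functions on
  \<open>\<real>\<^sup>d\<close>, integrated over a fundamental cell.\<close>

definition periodic :: "('n \<Rightarrow> real^'n) \<Rightarrow> (real^'n \<Rightarrow> 'b) \<Rightarrow> bool" where
  "periodic v f \<longleftrightarrow>
     (\<forall>x (z :: 'n \<Rightarrow> int). f (x + (\<Sum>j\<in>UNIV. of_int (z j) *\<^sub>R v j)) = f x)"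

definition cell :: "('n \<Rightarrow> real^'n) \<Rightarrow> (real^'n) set" where
  "cell v = {\<Sum>j\<in>UNIV. t j *\<^sub>R v j | t. \<forall>j. 0 \<le> t j \<and> t j < 1}"

definition torus_rigidity :: "(('n::{finite,linorder}) \<Rightarrow> 'n vector) \<Rightarrow> real \<Rightarrow> real \<Rightarrow> real \<Rightarrow> bool" where
  "torus_rigidity v p C1 C2 \<longleftrightarrow>
     rigidity_estimate {V. periodic v V} {U. smooth_on UNIV U \<and> periodic v U}
       (lebesgue_on (cell v)) p C1 C2"

end

theory Submission
  imports Defs
begin

text \<open>
  The proof is the substitution \<open>x \<mapsto> \<eta> x\<close>. Let \<open>U x = V (\<eta> x)\<close> be the pullback of a field \<open>V\<close> on the
  scaled manifold. The change of variables scales \<open>L\<^sup>q\<close> norms by \<open>\<eta>\<^bsup>-d/q\<^esup>\<close>, and the chain rule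
  contributes one more factor \<open>\<eta>\<close> to the exterior derivative. Hence pulling back multiplies the norms
  of \<open>V - R\<close> and of \<open>dist (V, SO)\<close> by the same factor \<open>\<eta>\<^bsup>-d/2\<^esup>\<close>, which is why \<open>C1\<close> is unchanged, whereas
  the norm of the exterior derivative is multiplied by \<open>\<eta>\<^bsup>1-d/p\<^esup>\<close>. The quotient of the two factors is
  the power of \<open>\<eta>\<close> in front of \<open>C2\<close>.

  Since \<open>dV\<close> is a limit of exterior derivatives of smooth fields, the chain rule is applied only to
  the approximating fields: an approximating sequence for \<open>V\<close> pulls back to one for \<open>U\<close>, and
  representatives of \<open>dV\<close> pull back to representatives of \<open>dU\<close>. The rotation that the estimate on the
  unscaled manifold provides for \<open>U\<close> then serves for \<open>V\<close>.

  The lemma \<open>rigidity_estimate_scaled\<close> carries this out for a measurable set and any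
  classes of admissible fields that are mapped into each other by the pullback. Open domains and
  fundamental cells of tori are the two instances.
\<close>

section \<open>Change of variables under a dilation\<close>

lemma measurable_lebesgue_on_scaleR:
  fixes A :: "'a::euclidean_space set"
  shows "(*\<^sub>R) c \<in> lebesgue_on A \<rightarrow>\<^sub>M lebesgue_on ((*\<^sub>R) c ` A)"
  by (rule measurable_restrict_space3) auto

lemma sets_lebesgue_scaleR_image:
  fixes A :: "'a::euclidean_space set"
  assumes "A \<in> sets lebesgue"
  shows "(*\<^sub>R) c ` A \<in> sets lebesgue"
  by (rule differentiable_image_in_sets_lebesgue[OF assms]) auto

lemma borel_measurable_scaled_iff:
  fixes A :: "'a::euclidean_space set"
  assumes "\<eta> > 0"
  shows "f \<in> borel_measurable (lebesgue_on ((*\<^sub>R) \<eta> ` A)) \<longleftrightarrow>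
         (\<lambda>x. f (\<eta> *\<^sub>R x)) \<in> borel_measurable (lebesgue_on A)"
proof
  assume "f \<in> borel_measurable (lebesgue_on ((*\<^sub>R) \<eta> ` A))"
  from measurable_compose[OF measurable_lebesgue_on_scaleR this]
  show "(\<lambda>x. f (\<eta> *\<^sub>R x)) \<in> borel_measurable (lebesgue_on A)" .
next
  assume f: "(\<lambda>x. f (\<eta> *\<^sub>R x)) \<in> borel_measurable (lebesgue_on A)"
  have "(*\<^sub>R) (1 / \<eta>) \<in> lebesgue_on ((*\<^sub>R) \<eta> ` A) \<rightarrow>\<^sub>M lebesgue_on A"
    using measurable_lebesgue_on_scaleR[of "1 / \<eta>" "(*\<^sub>R) \<eta> ` A"] assms
    by (simp add: image_image)
  from measurable_compose[OF this f]
  show "f \<in> borel_measurable (lebesgue_on ((*\<^sub>R) \<eta> ` A))"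
    using assms by simp
qed

lemma lebesgue_on_scaled_eq_density:
  fixes A :: "'a::euclidean_space set"
  assumes "\<eta> > 0" and A: "A \<in> sets lebesgue"
  shows "lebesgue_on ((*\<^sub>R) \<eta> ` A) =
    density (distr (lebesgue_on A) (lebesgue_on ((*\<^sub>R) \<eta> ` A)) ((*\<^sub>R) \<eta>)) (\<lambda>_. ennreal (\<eta> ^ DIM('a)))"
proof (rule measure_eqI)
  fix B assume B: "B \<in> sets (lebesgue_on ((*\<^sub>R) \<eta> ` A))"
  define B' where "B' = (*\<^sub>R) \<eta> -` B \<inter> A"
  have sub: "B \<subseteq> (*\<^sub>R) \<eta> ` A"
    using sets.sets_into_space[OF B] by simp
  have B'_set: "B' \<in> sets (lebesgue_on A)"
    using measurable_sets[OF measurable_lebesgue_on_scaleR B] by (simp add: B'_def)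
  then have B'_sub: "B' \<subseteq> A" by (simp add: B'_def)
  have img: "B = (*\<^sub>R) \<eta> ` B'"
    using sub unfolding B'_def by blast
  have "emeasure (lebesgue_on ((*\<^sub>R) \<eta> ` A)) B = emeasure lebesgue B"
    using sub sets_lebesgue_scaleR_image[OF A] by (simp add: emeasure_restrict_space)
  also have "\<dots> = ennreal (\<eta> ^ DIM('a)) * emeasure lebesgue B'"
    using emeasure_lebesgue_affine[of \<eta> 0 B'] assms(1) by (simp add: img)
  also have "emeasure lebesgue B' = emeasure (lebesgue_on A) B'"
    using B'_sub A by (simp add: emeasure_restrict_space)
  also have "\<dots> = emeasure (distr (lebesgue_on A) (lebesgue_on ((*\<^sub>R) \<eta> ` A)) ((*\<^sub>R) \<eta>)) B"
    using B by (subst emeasure_distr[OF measurable_lebesgue_on_scaleR]) (simp_all add: B'_def)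
  finally show "emeasure (lebesgue_on ((*\<^sub>R) \<eta> ` A)) B = emeasure (density
      (distr (lebesgue_on A) (lebesgue_on ((*\<^sub>R) \<eta> ` A)) ((*\<^sub>R) \<eta>)) (\<lambda>_. ennreal (\<eta> ^ DIM('a)))) B"
    using B by (simp add: emeasure_density nn_integral_cmult_indicator)
qed simp

lemma
  fixes A :: "'a::euclidean_space set" and f :: "'a \<Rightarrow> 'b::{banach, second_countable_topology}"
  assumes \<eta>: "\<eta> > 0" and A: "A \<in> sets lebesgue"
  shows integrable_scaled_iff: "integrable (lebesgue_on ((*\<^sub>R) \<eta> ` A)) f \<longleftrightarrow>
          integrable (lebesgue_on A) (\<lambda>x. f (\<eta> *\<^sub>R x))" (is ?integrable)
    and integral_scaled: "(\<integral>x. f x \<partial>lebesgue_on ((*\<^sub>R) \<eta> ` A)) =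
          \<eta> ^ DIM('a) *\<^sub>R (\<integral>x. f (\<eta> *\<^sub>R x) \<partial>lebesgue_on A)" (is ?integral)
proof -
  let ?N = "lebesgue_on ((*\<^sub>R) \<eta> ` A)"
  have "?integrable \<and> ?integral" if f: "f \<in> borel_measurable ?N"
  proof
    have f': "f \<in> borel_measurable (distr (lebesgue_on A) ?N ((*\<^sub>R) \<eta>))"
      using f by simp
    have g: "(\<lambda>x. \<eta> ^ DIM('a) *\<^sub>R f x) \<in> borel_measurable ?N"
      using f by simp
    have "integrable (lebesgue_on A) (\<lambda>x. \<eta> ^ DIM('a) *\<^sub>R f (\<eta> *\<^sub>R x)) \<longleftrightarrow>
          integrable (lebesgue_on A) (\<lambda>x. f (\<eta> *\<^sub>R x))"
    proof
      assume "integrable (lebesgue_on A) (\<lambda>x. \<eta> ^ DIM('a) *\<^sub>R f (\<eta> *\<^sub>R x))"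
      then have "integrable (lebesgue_on A) (\<lambda>x. (1 / \<eta> ^ DIM('a)) *\<^sub>R \<eta> ^ DIM('a) *\<^sub>R f (\<eta> *\<^sub>R x))"
        by (rule integrable_scaleR_right)
      then show "integrable (lebesgue_on A) (\<lambda>x. f (\<eta> *\<^sub>R x))"
        using \<eta> by simp
    qed simp
    then show ?integrable
      by (subst lebesgue_on_scaled_eq_density[OF assms])
         (use \<eta> f f' in \<open>simp add: integrable_density
            integrable_distr_eq[OF measurable_lebesgue_on_scaleR g]\<close>)
    show ?integral
      by (subst lebesgue_on_scaled_eq_density[OF assms])
         (use \<eta> f f' in \<open>simp add: integral_density
            integral_distr[OF measurable_lebesgue_on_scaleR f]\<close>)
  qed
  \<comment> \<open>Otherwise neither integrand is measurable, and both integrals have the default value \<open>0\<close>.\<close>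
  moreover have "?integrable \<and> ?integral" if "f \<notin> borel_measurable ?N"
  proof -
    have "\<not> integrable ?N f" "\<not> integrable (lebesgue_on A) (\<lambda>x. f (\<eta> *\<^sub>R x))"
      using that borel_measurable_scaled_iff[OF \<eta>, of f A] borel_measurable_integrable by blast+
    then show ?thesis by (simp add: not_integrable_integral_eq)
  qed
  ultimately show ?integrable ?integral by blast+
qed

section \<open>Scaling of Lebesgue norms\<close>

lemma Lp_scaled:
  fixes f :: "'a::euclidean_space \<Rightarrow> 'b::euclidean_space"
  assumes \<eta>: "\<eta> > 0" and A: "A \<in> sets lebesgue"
    and f: "f \<in> Lp p (lebesgue_on ((*\<^sub>R) \<eta> ` A))"
  shows "(\<lambda>x. c *\<^sub>R f (\<eta> *\<^sub>R x)) \<in> Lp p (lebesgue_on A)"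
proof -
  have "integrable (lebesgue_on A) (\<lambda>x. norm (f (\<eta> *\<^sub>R x)) powr p)"
    using f integrable_scaled_iff[OF \<eta> A, of "\<lambda>x. norm (f x) powr p"] by (simp add: Lp_def)
  then have "integrable (lebesgue_on A) (\<lambda>x. \<bar>c\<bar> powr p * norm (f (\<eta> *\<^sub>R x)) powr p)"
    by simp
  moreover have "(\<lambda>x. f (\<eta> *\<^sub>R x)) \<in> borel_measurable (lebesgue_on A)"
    using f borel_measurable_scaled_iff[OF \<eta>, of f A] by (simp add: Lp_def)
  ultimately show ?thesis by (simp add: Lp_def powr_mult)
qed

lemma Lp_cong:
  assumes "\<And>x. x \<in> space \<mu> \<Longrightarrow> f x = g x"
  shows "f \<in> Lp p \<mu> \<longleftrightarrow> g \<in> Lp p \<mu>"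
proof -
  have "f \<in> borel_measurable \<mu> \<longleftrightarrow> g \<in> borel_measurable \<mu>"
    using assms by (rule measurable_cong)
  moreover have "integrable \<mu> (\<lambda>x. norm (f x) powr p) \<longleftrightarrow> integrable \<mu> (\<lambda>x. norm (g x) powr p)"
    by (rule Bochner_Integration.integrable_cong) (simp_all add: assms)
  ultimately show ?thesis by (simp add: Lp_def)
qed

lemma Lp_norm_cong:
  assumes "\<And>x. x \<in> space \<mu> \<Longrightarrow> f x = g x"
  shows "Lp_norm p \<mu> f = Lp_norm p \<mu> g"
proof -
  have "(\<integral>x. norm (f x) powr p \<partial>\<mu>) = (\<integral>x. norm (g x) powr p \<partial>\<mu>)"
    by (rule Bochner_Integration.integral_cong) (simp_all add: assms)
  then show ?thesis by (simp add: Lp_norm_def)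
qed

lemma Lp_norm_scaled:
  fixes f :: "'a::euclidean_space \<Rightarrow> 'b::euclidean_space"
  assumes \<eta>: "\<eta> > 0" and A: "A \<in> sets lebesgue" and p: "p > 0"
  shows "Lp_norm p (lebesgue_on A) (\<lambda>x. c *\<^sub>R f (\<eta> *\<^sub>R x)) =
         \<bar>c\<bar> * \<eta> powr (- real DIM('a) / p) * Lp_norm p (lebesgue_on ((*\<^sub>R) \<eta> ` A)) f"
proof -
  let ?I = "\<integral>x. norm (f x) powr p \<partial>lebesgue_on ((*\<^sub>R) \<eta> ` A)"
  have "?I = \<eta> ^ DIM('a) * (\<integral>x. norm (f (\<eta> *\<^sub>R x)) powr p \<partial>lebesgue_on A)"
    using integral_scaled[OF \<eta> A, of "\<lambda>x. norm (f x) powr p"] by simp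
  then have *: "(\<integral>x. norm (f (\<eta> *\<^sub>R x)) powr p \<partial>lebesgue_on A) = \<eta> powr (- real DIM('a)) * ?I"
    using \<eta> by (simp add: powr_minus powr_realpow field_simps)
  have "Lp_norm p (lebesgue_on A) (\<lambda>x. c *\<^sub>R f (\<eta> *\<^sub>R x)) =
        (\<bar>c\<bar> powr p * (\<eta> powr (- real DIM('a)) * ?I)) powr (1 / p)"
    by (simp add: Lp_norm_def powr_mult *)
  also have "\<dots> = \<bar>c\<bar> * (\<eta> powr (- real DIM('a) / p) * ?I powr (1 / p))"
    using p by (simp add: powr_mult powr_powr)
  finally show ?thesis by (simp add: Lp_norm_def)
qed

section \<open>Scaling of two-forms\<close>

text \<open>The factor \<open>\<eta>\<close> is the one that the chain rule produces: these are the coefficients of the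
  pullback of \<open>W\<close> under \<open>x \<mapsto> \<eta> x\<close>, divided by \<open>\<eta>\<close>. The division accounts for pulling back a vector
  of 1-forms as a mere matrix field, without its differential \<open>\<eta> dx\<^sub>j\<close>.\<close>

definition scaled_forms :: "real \<Rightarrow> ('n::finite) two_forms \<Rightarrow> 'n two_forms" where
  "scaled_forms \<eta> W = (\<lambda>i k l x. \<eta> * W i k l (\<eta> *\<^sub>R x))"

text \<open>Equality on \<open>A\<close> is all that the chain rule gives: off \<open>A\<close>, the fields of an approximating
  sequence on a domain are arbitrary, and \<^const>\<open>ext_d\<close> is then an arbitrary value.\<close>

definition forms_eq_on :: "'n vector set \<Rightarrow> 'n two_forms \<Rightarrow> 'n two_forms \<Rightarrow> bool" where
  "forms_eq_on A W W' \<longleftrightarrow> (\<forall>i k l. \<forall>x\<in>A. W i k l x = W' i k l x)"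

lemma forms_Lp_cong:
  assumes "forms_eq_on A W W'"
  shows "W \<in> forms_Lp p (lebesgue_on A) \<longleftrightarrow> W' \<in> forms_Lp p (lebesgue_on A)"
proof -
  have "W i k l \<in> Lp p (lebesgue_on A) \<longleftrightarrow> W' i k l \<in> Lp p (lebesgue_on A)" for i k l
    by (rule Lp_cong) (use assms in \<open>simp add: forms_eq_on_def\<close>)
  then show ?thesis by (simp add: forms_Lp_def)
qed

lemma forms_norm_cong:
  assumes "forms_eq_on A W W'"
  shows "forms_norm p (lebesgue_on A) W = forms_norm p (lebesgue_on A) W'"
proof -
  have "Lp_norm p (lebesgue_on A) (W i k l) = Lp_norm p (lebesgue_on A) (W' i k l)" for i k l
    by (rule Lp_norm_cong) (use assms in \<open>simp add: forms_eq_on_def\<close>)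
  then show ?thesis by (simp add: forms_norm_def)
qed

lemma forms_Lp_scaled:
  fixes W :: "('n::{finite,linorder}) two_forms"
  assumes "\<eta> > 0" "A \<in> sets lebesgue" "W \<in> forms_Lp p (lebesgue_on ((*\<^sub>R) \<eta> ` A))"
  shows "scaled_forms \<eta> W \<in> forms_Lp p (lebesgue_on A)"
  using Lp_scaled[OF assms(1,2), where c = \<eta> and 'b = real] assms(3)
  by (simp add: forms_Lp_def scaled_forms_def)

lemma forms_norm_scaled:
  fixes W :: "('n::{finite,linorder}) two_forms"
  assumes \<eta>: "\<eta> > 0" and A: "A \<in> sets lebesgue" and p: "p > 0"
  shows "forms_norm p (lebesgue_on A) (scaled_forms \<eta> W) =
         \<eta> powr (1 - real CARD('n) / p) * forms_norm p (lebesgue_on ((*\<^sub>R) \<eta> ` A)) W"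
proof -
  let ?K = "\<eta> powr (1 - real CARD('n) / p)"
  have "Lp_norm p (lebesgue_on A) (scaled_forms \<eta> W i k l) =
        ?K * Lp_norm p (lebesgue_on ((*\<^sub>R) \<eta> ` A)) (W i k l)" for i k l
    using Lp_norm_scaled[OF assms, of \<eta> "W i k l"] \<eta>
    by (simp add: scaled_forms_def powr_diff powr_minus field_simps)
  then have "forms_norm p (lebesgue_on A) (scaled_forms \<eta> W) =
      (?K powr p * (\<Sum>i\<in>UNIV. \<Sum>(k, l)\<in>{(k, l). k < l}.
         Lp_norm p (lebesgue_on ((*\<^sub>R) \<eta> ` A)) (W i k l) powr p)) powr (1 / p)"
    by (simp add: forms_norm_def powr_mult sum_distrib_left case_prod_unfold)
  also have "\<dots> = ?K * forms_norm p (lebesgue_on ((*\<^sub>R) \<eta> ` A)) W"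
    using p by (simp add: forms_norm_def powr_mult powr_powr)
  finally show ?thesis .
qed

section \<open>The chain rule for a dilation\<close>

lemma differentiable_scaled:
  fixes f :: "'a::real_normed_vector \<Rightarrow> 'b::real_normed_vector"
  assumes "f differentiable (at (\<eta> *\<^sub>R x))"
  shows "(\<lambda>y. f (\<eta> *\<^sub>R y)) differentiable (at x)"
  using differentiable_chain_at[of "(*\<^sub>R) \<eta>" x f] assms by (simp add: o_def)

lemma partial_scaled:
  assumes "f differentiable (at (\<eta> *\<^sub>R x))"
  shows "partial k (\<lambda>y. f (\<eta> *\<^sub>R y)) x = \<eta> *\<^sub>R partial k f (\<eta> *\<^sub>R x)"
proof -
  have f: "(f has_derivative frechet_derivative f (at (\<eta> *\<^sub>R x))) (at (\<eta> *\<^sub>R x))"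
    using assms by (simp add: frechet_derivative_works)
  have "((\<lambda>y. \<eta> *\<^sub>R y) has_derivative (\<lambda>y. \<eta> *\<^sub>R y)) (at x)"
    by (auto intro!: derivative_eq_intros)
  from diff_chain_at[OF this f]
  have "((\<lambda>y. f (\<eta> *\<^sub>R y)) has_derivative
        (\<lambda>y. frechet_derivative f (at (\<eta> *\<^sub>R x)) (\<eta> *\<^sub>R y))) (at x)"
    by (simp add: o_def)
  then have "frechet_derivative (\<lambda>y. f (\<eta> *\<^sub>R y)) (at x) =
        (\<lambda>y. frechet_derivative f (at (\<eta> *\<^sub>R x)) (\<eta> *\<^sub>R y))"
    by (metis frechet_derivative_at)
  then show ?thesis
    using linear_frechet_derivative[OF assms] by (simp add: partial_def linear_cmul)
qed

text \<open>Differentiating \<open>g\<close> once more produces another factor \<open>\<eta>\<close>, and the resulting identity again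
  holds only on \<open>U\<close>; the constant \<open>c\<close> and the restriction to \<open>U\<close> make the induction go through.\<close>

lemma Ck_on_scaled:
  fixes f g :: "real^'n \<Rightarrow> 'b::real_normed_vector"
  assumes "open U" and "\<And>x. x \<in> U \<Longrightarrow> g x = c *\<^sub>R f (\<eta> *\<^sub>R x)" and "Ck_on m ((*\<^sub>R) \<eta> ` U) f"
  shows "Ck_on m U g"
  using assms(2,3)
proof (induction m arbitrary: f g c)
  case 0
  have "continuous_on U (\<lambda>x. f (\<eta> *\<^sub>R x))"
    by (rule continuous_on_compose2[of "(*\<^sub>R) \<eta> ` U"])
       (use 0 in \<open>auto intro!: continuous_intros\<close>)
  then have "continuous_on U (\<lambda>x. c *\<^sub>R f (\<eta> *\<^sub>R x))"
    by (intro continuous_intros)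
  moreover have "continuous_on U g \<longleftrightarrow> continuous_on U (\<lambda>x. c *\<^sub>R f (\<eta> *\<^sub>R x))"
    by (rule continuous_on_cong) (simp_all add: 0)
  ultimately show ?case by simp
next
  case (Suc m)
  have f: "f differentiable (at (\<eta> *\<^sub>R x))" if "x \<in> U" for x
    using Suc.prems(2) that by auto
  have h: "(\<lambda>y. c *\<^sub>R f (\<eta> *\<^sub>R y)) differentiable (at x)" if "x \<in> U" for x
    using differentiable_scaled[OF f[OF that]] by (intro differentiable_scaleR) auto
  have g: "g differentiable (at x)" if "x \<in> U" for x
    using has_derivative_transform_within_open[OF _ assms(1) that, of _ _ UNIV g] h[OF that] Suc.prems(1)
    unfolding differentiable_def by metis
  have partial_g: "partial k g x = (c * \<eta>) *\<^sub>R partial k f (\<eta> *\<^sub>R x)" if "x \<in> U" for k x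
  proof -
    have "partial k g x = partial k (\<lambda>y. c *\<^sub>R f (\<eta> *\<^sub>R y)) x"
      unfolding partial_def
      by (subst frechet_derivative_transform_within_open[OF g[OF that] assms(1) that])
         (simp_all add: Suc.prems(1))
    also have "\<dots> = c *\<^sub>R partial k (\<lambda>y. f (\<eta> *\<^sub>R y)) x"
    proof -
      have "((\<lambda>y. f (\<eta> *\<^sub>R y)) has_derivative
              frechet_derivative (\<lambda>y. f (\<eta> *\<^sub>R y)) (at x)) (at x)"
        using differentiable_scaled[OF f[OF that]] by (simp add: frechet_derivative_works)
      from has_derivative_scaleR_right[OF this, of c] show ?thesis
        unfolding partial_def by (metis frechet_derivative_at)
    qed
    finally show ?thesis using partial_scaled[OF f[OF that]] by simp
  qed
  have "Ck_on m U (partial k g)" for k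
    by (rule Suc.IH[where f = "partial k f" and c = "c * \<eta>"]) (use partial_g Suc.prems(2) in auto)
  then show ?case using g by simp
qed

lemma smooth_on_scaled:
  assumes "open U" and "smooth_on ((*\<^sub>R) \<eta> ` U) f"
  shows "smooth_on U (\<lambda>x. f (\<eta> *\<^sub>R x))"
  using assms Ck_on_scaled[of U "\<lambda>x. f (\<eta> *\<^sub>R x)" 1 f \<eta>] by (auto simp: smooth_on_def)

lemma smooth_on_imp_differentiable:
  assumes "smooth_on U f" "x \<in> U"
  shows "f differentiable (at x)"
  using assms Ck_on.simps(2)[of 0 U f] by (auto simp: smooth_on_def)

lemma ext_d_scaled:
  fixes V :: "('n::finite) field_of_matrices"
  assumes "\<And>x. x \<in> A \<Longrightarrow> V differentiable (at (\<eta> *\<^sub>R x))"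
  shows "forms_eq_on A (ext_d (\<lambda>x. V (\<eta> *\<^sub>R x))) (scaled_forms \<eta> (ext_d V))"
  unfolding forms_eq_on_def
proof (intro allI ballI)
  fix i k l x assume x: "x \<in> A"
  have "(\<lambda>y. V y $ i $ j) differentiable (at (\<eta> *\<^sub>R x))" for j
  proof -
    have "bounded_linear (\<lambda>B :: real^'n^'n. B $ i $ j)"
      by (intro bounded_linear_compose[OF bounded_linear_vec_nth bounded_linear_vec_nth])
    then show ?thesis
      using assms[OF x] bounded_linear.has_derivative unfolding differentiable_def by blast
  qed
  then show "ext_d (\<lambda>x. V (\<eta> *\<^sub>R x)) i k l x = scaled_forms \<eta> (ext_d V) i k l x"
    by (simp add: ext_d_def scaled_forms_def partial_scaled right_diff_distrib
        partial_scaled[where f = "\<lambda>y. V y $ i $ _"])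
qed

section \<open>Scaling of the rigidity estimate\<close>

lemma forms_diff_scaled:
  assumes "forms_eq_on A W (scaled_forms \<eta> X)" "forms_eq_on A W' (scaled_forms \<eta> X')"
  shows "forms_eq_on A (forms_diff W W') (scaled_forms \<eta> (forms_diff X X'))"
  using assms by (simp add: forms_eq_on_def forms_diff_def scaled_forms_def right_diff_distrib)

lemma approx_seq_scaled:
  fixes V :: "('n::{finite,linorder}) field_of_matrices"
  assumes \<eta>: "\<eta> > 0" and A: "A \<in> sets lebesgue" and p: "p > 0"
    and S: "\<And>U. U \<in> S' \<Longrightarrow> (\<lambda>x. U (\<eta> *\<^sub>R x)) \<in> S"
    and diff: "\<And>U x. U \<in> S' \<Longrightarrow> x \<in> A \<Longrightarrow> U differentiable (at (\<eta> *\<^sub>R x))"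
    and V: "approx_seq S' (lebesgue_on ((*\<^sub>R) \<eta> ` A)) p V Vn"
  shows "approx_seq S (lebesgue_on A) p (\<lambda>x. V (\<eta> *\<^sub>R x)) (\<lambda>n x. Vn n (\<eta> *\<^sub>R x))"
  unfolding approx_seq_def
proof (intro conjI allI impI)
  let ?\<mu> = "lebesgue_on A" and ?\<mu>' = "lebesgue_on ((*\<^sub>R) \<eta> ` A)"
  let ?K = "\<eta> powr (1 - real CARD('n) / p)"
  have K: "?K > 0" using \<eta> by simp
  have Vn: "Vn n \<in> S'" "Vn n \<in> Lp 2 ?\<mu>'" "ext_d (Vn n) \<in> forms_Lp p ?\<mu>'" for n
    using V by (auto simp: approx_seq_def)
  have d: "forms_eq_on A (ext_d (\<lambda>x. Vn n (\<eta> *\<^sub>R x))) (scaled_forms \<eta> (ext_d (Vn n)))" for n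
    by (rule ext_d_scaled) (rule diff[OF Vn(1)])
  show "(\<lambda>x. Vn n (\<eta> *\<^sub>R x)) \<in> S \<inter> Lp 2 ?\<mu>" for n
    using S[OF Vn(1)] Lp_scaled[OF \<eta> A Vn(2), of 1 n] by simp
  show "ext_d (\<lambda>x. Vn n (\<eta> *\<^sub>R x)) \<in> forms_Lp p ?\<mu>" for n
    using forms_Lp_cong[OF d] forms_Lp_scaled[OF \<eta> A Vn(3)] by blast
  have "(\<lambda>n. \<eta> powr (- real CARD('n) / 2) * Lp_norm 2 ?\<mu>' (\<lambda>x. Vn n x - V x)) \<longlonglongrightarrow> 0"
    using V by (intro tendsto_mult_right_zero) (simp add: approx_seq_def)
  then show "(\<lambda>n. Lp_norm 2 ?\<mu> (\<lambda>x. Vn n (\<eta> *\<^sub>R x) - V (\<eta> *\<^sub>R x))) \<longlonglongrightarrow> 0"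
    using Lp_norm_scaled[OF \<eta> A, of 2 1 "\<lambda>x. Vn _ x - V x"] by simp
  have norm_eq: "forms_norm p ?\<mu> (forms_diff (ext_d (\<lambda>x. Vn m (\<eta> *\<^sub>R x))) (ext_d (\<lambda>x. Vn n (\<eta> *\<^sub>R x))))
      = ?K * forms_norm p ?\<mu>' (forms_diff (ext_d (Vn m)) (ext_d (Vn n)))" for m n
    using forms_norm_cong[OF forms_diff_scaled[OF d d]] forms_norm_scaled[OF \<eta> A p] by metis
  fix e :: real assume "e > 0"
  then have "e / ?K > 0" using K by simp
  then obtain N where "\<forall>m\<ge>N. \<forall>n\<ge>N. forms_norm p ?\<mu>' (forms_diff (ext_d (Vn m)) (ext_d (Vn n))) < e / ?K"
    using V unfolding approx_seq_def by blast
  then show "\<exists>N. \<forall>m\<ge>N. \<forall>n\<ge>N. forms_norm p ?\<mu>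
      (forms_diff (ext_d (\<lambda>x. Vn m (\<eta> *\<^sub>R x))) (ext_d (\<lambda>x. Vn n (\<eta> *\<^sub>R x)))) < e"
    using K unfolding norm_eq by (simp add: pos_less_divide_eq mult.commute) blast
qed

lemma is_ext_d_scaled:
  fixes V :: "('n::{finite,linorder}) field_of_matrices"
  assumes \<eta>: "\<eta> > 0" and A: "A \<in> sets lebesgue" and p: "p > 0"
    and S: "\<And>U. U \<in> S' \<Longrightarrow> (\<lambda>x. U (\<eta> *\<^sub>R x)) \<in> S"
    and diff: "\<And>U x. U \<in> S' \<Longrightarrow> x \<in> A \<Longrightarrow> U differentiable (at (\<eta> *\<^sub>R x))"
    and W: "is_ext_d S' (lebesgue_on ((*\<^sub>R) \<eta> ` A)) p V W"
  shows "is_ext_d S (lebesgue_on A) p (\<lambda>x. V (\<eta> *\<^sub>R x)) (scaled_forms \<eta> W)"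
proof -
  let ?\<mu> = "lebesgue_on A" and ?\<mu>' = "lebesgue_on ((*\<^sub>R) \<eta> ` A)"
  let ?K = "\<eta> powr (1 - real CARD('n) / p)"
  obtain Vn where Vn: "approx_seq S' ?\<mu>' p V Vn"
    and lim: "(\<lambda>n. forms_norm p ?\<mu>' (forms_diff (ext_d (Vn n)) W)) \<longlonglongrightarrow> 0"
    using W by (auto simp: is_ext_d_def)
  have d: "forms_eq_on A (ext_d (\<lambda>x. Vn n (\<eta> *\<^sub>R x))) (scaled_forms \<eta> (ext_d (Vn n)))" for n
    by (rule ext_d_scaled, rule diff) (use Vn in \<open>auto simp: approx_seq_def\<close>)
  have "forms_eq_on A (scaled_forms \<eta> W) (scaled_forms \<eta> W)"
    by (simp add: forms_eq_on_def)
  then have norm_eq: "forms_norm p ?\<mu> (forms_diff (ext_d (\<lambda>x. Vn n (\<eta> *\<^sub>R x))) (scaled_forms \<eta> W))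
      = ?K * forms_norm p ?\<mu>' (forms_diff (ext_d (Vn n)) W)" for n
    using forms_norm_cong[OF forms_diff_scaled[OF d]] forms_norm_scaled[OF \<eta> A p] by metis
  have "(\<lambda>n. forms_norm p ?\<mu> (forms_diff (ext_d (\<lambda>x. Vn n (\<eta> *\<^sub>R x))) (scaled_forms \<eta> W))) \<longlonglongrightarrow> 0"
    unfolding norm_eq using lim by (rule tendsto_mult_right_zero)
  moreover have "scaled_forms \<eta> W \<in> forms_Lp p ?\<mu>"
    using W forms_Lp_scaled[OF \<eta> A] by (simp add: is_ext_d_def)
  ultimately show ?thesis
    using approx_seq_scaled[OF \<eta> A p S diff Vn] unfolding is_ext_d_def by blast
qed

lemma rigidity_estimate_scaled:
  fixes F F' S S' :: "('n::{finite,linorder}) field_of_matrices set"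
  assumes \<eta>: "\<eta> > 0" and A: "A \<in> sets lebesgue" and p: "p > 0"
    and F: "\<And>V. V \<in> F' \<Longrightarrow> (\<lambda>x. V (\<eta> *\<^sub>R x)) \<in> F"
    and S: "\<And>U. U \<in> S' \<Longrightarrow> (\<lambda>x. U (\<eta> *\<^sub>R x)) \<in> S"
    and diff: "\<And>U x. U \<in> S' \<Longrightarrow> x \<in> A \<Longrightarrow> U differentiable (at (\<eta> *\<^sub>R x))"
    and rigid: "rigidity_estimate F S (lebesgue_on A) p C1 C2"
  shows "rigidity_estimate F' S' (lebesgue_on ((*\<^sub>R) \<eta> ` A)) p C1
           (\<eta> powr (real CARD('n) / 2 - real CARD('n) / p + 1) * C2)"
  unfolding rigidity_estimate_def
proof (intro ballI impI)
  let ?\<mu> = "lebesgue_on A" and ?\<mu>' = "lebesgue_on ((*\<^sub>R) \<eta> ` A)"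
  let ?k = "\<eta> powr (real CARD('n) / 2)" and ?K = "\<eta> powr (1 - real CARD('n) / p)"
  fix V assume V: "V \<in> F' \<inter> Lp 2 ?\<mu>'" and ext: "ext_d_in_Lp S' ?\<mu>' p V"
  have "(\<lambda>x. V (\<eta> *\<^sub>R x)) \<in> F \<inter> Lp 2 ?\<mu>"
    using V F Lp_scaled[OF \<eta> A, of V 2 1] by simp
  moreover have "ext_d_in_Lp S ?\<mu> p (\<lambda>x. V (\<eta> *\<^sub>R x))"
    using ext approx_seq_scaled[OF \<eta> A p S diff] unfolding ext_d_in_Lp_def by blast
  ultimately obtain R where R: "R \<in> SO" and
    est: "\<And>W. is_ext_d S ?\<mu> p (\<lambda>x. V (\<eta> *\<^sub>R x)) W \<Longrightarrow>
      Lp_norm 2 ?\<mu> (\<lambda>x. V (\<eta> *\<^sub>R x) - R) \<le>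
        C1 * Lp_norm 2 ?\<mu> (\<lambda>x. infdist (V (\<eta> *\<^sub>R x)) SO) + C2 * forms_norm p ?\<mu> W"
    using rigid unfolding rigidity_estimate_def by blast
  have norm2: "Lp_norm 2 ?\<mu>' f = ?k * Lp_norm 2 ?\<mu> (\<lambda>x. f (\<eta> *\<^sub>R x))"
    for f :: "'n vector \<Rightarrow> 'b::euclidean_space"
    using Lp_norm_scaled[OF \<eta> A, of 2 1 f] \<eta> by (simp add: powr_minus field_simps)
  have "Lp_norm 2 ?\<mu>' (\<lambda>x. V x - R) \<le> C1 * Lp_norm 2 ?\<mu>' (\<lambda>x. infdist (V x) SO) +
      \<eta> powr (real CARD('n) / 2 - real CARD('n) / p + 1) * C2 * forms_norm p ?\<mu>' W"
    if W: "is_ext_d S' ?\<mu>' p V W" for W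
  proof -
    have "Lp_norm 2 ?\<mu>' (\<lambda>x. V x - R) = ?k * Lp_norm 2 ?\<mu> (\<lambda>x. V (\<eta> *\<^sub>R x) - R)"
      by (rule norm2)
    also have "\<dots> \<le> ?k * (C1 * Lp_norm 2 ?\<mu> (\<lambda>x. infdist (V (\<eta> *\<^sub>R x)) SO) +
        C2 * forms_norm p ?\<mu> (scaled_forms \<eta> W))"
      by (intro mult_left_mono est is_ext_d_scaled[OF \<eta> A p S diff W]) auto
    also have "\<dots> = C1 * Lp_norm 2 ?\<mu>' (\<lambda>x. infdist (V x) SO) + ?k * ?K * C2 * forms_norm p ?\<mu>' W"
      by (simp add: norm2[of "\<lambda>x. infdist (V x) SO"] forms_norm_scaled[OF \<eta> A p] algebra_simps)
    also have "?k * ?K = \<eta> powr (real CARD('n) / 2 - real CARD('n) / p + 1)"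
      by (simp add: powr_add[symmetric] algebra_simps)
    finally show ?thesis .
  qed
  with R show "\<exists>R\<in>SO. \<forall>W. is_ext_d S' ?\<mu>' p V W \<longrightarrow>
      Lp_norm 2 ?\<mu>' (\<lambda>x. V x - R) \<le> C1 * Lp_norm 2 ?\<mu>' (\<lambda>x. infdist (V x) SO) +
        \<eta> powr (real CARD('n) / 2 - real CARD('n) / p + 1) * C2 * forms_norm p ?\<mu>' W"
    by blast
qed

section \<open>Domains and tori\<close>

lemma domain_rigidity_scaled:
  fixes M :: "('n::{finite,linorder}) vector set"
  assumes "\<eta> > 0" "p > 0" "open M" "domain_rigidity M p C1 C2"
  shows "domain_rigidity ((*\<^sub>R) \<eta> ` M) p C1
           (\<eta> powr (real CARD('n) / 2 - real CARD('n) / p + 1) * C2)"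
  unfolding domain_rigidity_def
  by (rule rigidity_estimate_scaled[OF _ _ _ _ _ _ assms(4)[unfolded domain_rigidity_def]])
     (use assms in \<open>auto intro: smooth_on_scaled smooth_on_imp_differentiable lebesgue_openin\<close>)

lemma cell_scaled: "cell (\<lambda>j. \<eta> *\<^sub>R v j) = (*\<^sub>R) \<eta> ` cell v"
proof -
  have "(\<Sum>j\<in>UNIV. t j *\<^sub>R \<eta> *\<^sub>R v j) = \<eta> *\<^sub>R (\<Sum>j\<in>UNIV. t j *\<^sub>R v j)" for t
    by (simp add: scaleR_sum_right mult.commute)
  then show ?thesis unfolding cell_def by auto
qed

text \<open>A cell is a linear image of the half-open unit cube.\<close>

lemma sets_lebesgue_cell:
  fixes v :: "'n::finite \<Rightarrow> real^'n"
  shows "cell v \<in> sets lebesgue"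
proof -
  define T :: "real^'n \<Rightarrow> real^'n" where "T x = (\<Sum>j\<in>UNIV. x $ j *\<^sub>R v j)" for x
  let ?Q = "{x :: real^'n. \<forall>j. 0 \<le> x $ j \<and> x $ j < 1}"
  have "cell v = T ` ?Q"
  proof
    show "cell v \<subseteq> T ` ?Q"
    proof
      fix y assume "y \<in> cell v"
      then obtain t where t: "y = (\<Sum>j\<in>UNIV. t j *\<^sub>R v j)" "\<forall>j. 0 \<le> t j \<and> t j < 1"
        by (auto simp: cell_def)
      then have "y = T (\<chi> j. t j)" "(\<chi> j. t j) \<in> ?Q" by (simp_all add: T_def)
      then show "y \<in> T ` ?Q" by blast
    qed
    show "T ` ?Q \<subseteq> cell v" by (force simp: cell_def T_def)
  qed
  moreover have "?Q \<in> sets lebesgue"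
  proof -
    have "?Q \<in> sets borel" by measurable
    then show ?thesis by simp
  qed
  moreover have "linear T"
    by (rule linearI) (simp_all add: T_def scaleR_add_left sum.distrib scaleR_sum_right)
  ultimately show ?thesis
    by (simp only:) (rule differentiable_image_in_sets_lebesgue; simp add: linear_imp_differentiable_on)
qed

lemma periodic_scaled:
  assumes "periodic (\<lambda>j. \<eta> *\<^sub>R v j) f"
  shows "periodic v (\<lambda>x. f (\<eta> *\<^sub>R x))"
proof -
  have "\<eta> *\<^sub>R (x + (\<Sum>j\<in>UNIV. of_int (z j) *\<^sub>R v j)) =
        \<eta> *\<^sub>R x + (\<Sum>j\<in>UNIV. of_int (z j) *\<^sub>R \<eta> *\<^sub>R v j)" for x z
    by (simp add: scaleR_add_right scaleR_sum_right mult.commute)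
  then show ?thesis using assms unfolding periodic_def by metis
qed

lemma torus_rigidity_scaled:
  fixes v :: "('n::{finite,linorder}) \<Rightarrow> 'n vector"
  assumes \<eta>: "\<eta> > 0" and p: "p > 0" and rigid: "torus_rigidity v p C1 C2"
  shows "torus_rigidity (\<lambda>j. \<eta> *\<^sub>R v j) p C1
           (\<eta> powr (real CARD('n) / 2 - real CARD('n) / p + 1) * C2)"
proof -
  have surj: "(*\<^sub>R) \<eta> ` UNIV = (UNIV :: 'n vector set)"
  proof (intro equalityI subsetI)
    show "x \<in> (*\<^sub>R) \<eta> ` UNIV" for x :: "'n vector"
      using \<eta> by (intro image_eqI[of _ _ "(1 / \<eta>) *\<^sub>R x"]) auto
  qed simp
  have smooth: "smooth_on UNIV (\<lambda>x. U (\<eta> *\<^sub>R x))"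
    if "smooth_on UNIV U" for U :: "'n field_of_matrices"
    by (rule smooth_on_scaled) (simp_all add: surj that)
  show ?thesis
    unfolding torus_rigidity_def cell_scaled
    by (rule rigidity_estimate_scaled[OF _ _ _ _ _ _ rigid[unfolded torus_rigidity_def]])
       (use \<eta> p in
          \<open>auto intro: smooth periodic_scaled sets_lebesgue_cell smooth_on_imp_differentiable\<close>)
qed

theorem lemma2p4:
  fixes p \<eta> :: real
  assumes "CARD('n::{finite,linorder}) \<ge> 2" and "p \<ge> 1" and "\<eta> > 0"
  shows
    "(\<forall>(M :: ('n vector) set) C1 C2.
        open M \<and> connected M \<and> bounded M \<and> smooth_boundary M \<and>
        domain_rigidity M p C1 C2 \<longrightarrow>
        domain_rigidity ((\<lambda>x. \<eta> *\<^sub>R x) ` M) p C1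
          (\<eta> powr (real CARD('n) / 2 - real CARD('n) / p + 1) * C2)) \<and>
     (\<forall>(v :: 'n \<Rightarrow> 'n vector) C1 C2.
        inj v \<and> independent (range v) \<and>
        torus_rigidity v p C1 C2 \<longrightarrow>
        torus_rigidity (\<lambda>j. \<eta> *\<^sub>R v j) p C1
          (\<eta> powr (real CARD('n) / 2 - real CARD('n) / p + 1) * C2))"
  using assms(2,3) by (intro conjI allI impI domain_rigidity_scaled torus_rigidity_scaled) auto

end
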